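(* Let $\Omega\subseteq\mathbb{R}^d$, let $\kappa:\Omega\times\Omega\to\mathbb{R}$ be a strictly positive definite radial kernel, let $\mathcal{X}=\{\boldsymbol{x}_1,\dots,\boldsymbol{x}_n\}\subset\Omega$ be a set of $n$ distinct nodes, and let $\mathsf{A}=(\kappa(\boldsymbol{x}_i,\boldsymbol{x}_j))_{i,j=1,\dots,n}$. Let $\rho\in\mathbb{N}$ with $1\le\rho<n$, let $\boldsymbol{p}=(p_1,\dots,p_\rho)^{\intercal}$ be a vector of $\rho$ distinct indices in $\{1,\dots,n\}$, and let $\mathcal{V}=\{\boldsymbol{x}_{p_1},\dots,\boldsymbol{x}_{p_\rho}\}$. Then the power function vector $$\boldsymbol{P}^{\mathcal{V}}=\sqrt{\mathrm{diag}\big(\boldsymbol{k}_{\boldsymbol{p}}(\mathcal{V})-\boldsymbol{k}^{\boldsymbol{p}}(\mathcal{V})^{\intercal}(\mathsf{A}^{\boldsymbol{p},\boldsymbol{p}})^{-1}\boldsymbol{k}^{\boldsymbol{p}}(\mathcal{V})\big)}\in\mathbb{R}^\rho$$ satisfies $$\boldsymbol{P}^{\mathcal{V}}=\sqrt{\mathrm{sum}\Big(\big((\mathsf{A}^{-1}_{\boldsymbol{p},\boldsymbol{p}})^{-1}\,\mathsf{A}^{-1}_{\boldsymbol{p},:}\big)\odot\boldsymbol{k}(\mathcal{V})^{\intercal}\Big)}.$$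
   Context: A kernel $\kappa:\Omega\times\Omega\to\mathbb{R}$ is radial if there is a function $\varphi:\mathbb{R}_{\ge 0}\to\mathbb{R}$ with $\kappa(\boldsymbol{x},\boldsymbol{y})=\varphi(\|\boldsymbol{x}-\boldsymbol{y}\|_2)$ for all $\boldsymbol{x},\boldsymbol{y}\in\Omega$ (in particular $\kappa$ is symmetric). It is strictly positive definite if for every finite set of distinct points of $\Omega$ the associated kernel matrix is (symmetric) positive definite, hence invertible. Notation for matrices and indices. Indices in $\boldsymbol{p}$ are taken in the order $p_1,\dots,p_\rho$; indices not in $\boldsymbol{p}$ (the $n-\rho$ elements of $\{1,\dots,n\}\setminus\{p_1,\dots,p_\rho\}$) are taken in increasing order. - $\mathsf{A}^{\boldsymbol{p},\boldsymbol{p}}=(\mathsf{A}_{i,j})_{i,j\notin\boldsymbol{p}}$ is the $(n-\rho)\times(n-\rho)$ submatrix of $\mathsf{A}$ obtained by removing the rows and columns with indices in $\boldsymbol{p}$. - $\mathsf{A}^{-1}_{\boldsymbol{p},\boldsymbol{p}}=((\mathsf{A}^{-1})_{i,j})_{i,j\in\boldsymbol{p}}$ is the $\rho\times\rho$ submatrix of the inverse matrix $\mathsf{A}^{-1}$, and $(\mathsf{A}^{-1}_{\boldsymbol{p},\boldsymbol{p}})^{-1}$ is the inverse of this submatrix. - $\mathsf{A}^{-1}_{\boldsymbol{p},:}=((\mathsf{A}^{-1})_{i,j})_{i\in\boldsymbol{p},\,j\in\{1,\dots,n\}}$ is the $\rho\times n$ matrix formed by the rows of $\mathsf{A}^{-1}$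 with indices in $\boldsymbol{p}$. Kernel evaluations. For $\boldsymbol{x}\in\Omega$, $\boldsymbol{\kappa}(\boldsymbol{x})=(\kappa(\boldsymbol{x},\boldsymbol{x}_1),\dots,\kappa(\boldsymbol{x},\boldsymbol{x}_n))^{\intercal}$, and $\boldsymbol{k}_{\boldsymbol{p}}(\boldsymbol{x})$, $\boldsymbol{k}^{\boldsymbol{p}}(\boldsymbol{x})$ denote the subvectors of $\boldsymbol{\kappa}(\boldsymbol{x})$ with entries indexed by $i\in\boldsymbol{p}$ and by $i\notin\boldsymbol{p}$, respectively. Evaluation on $\mathcal{V}$ places these vectors side by side as columns, for $\boldsymbol{x}=\boldsymbol{x}_{p_1},\dots,\boldsymbol{x}_{p_\rho}$: - $\boldsymbol{k}(\mathcal{V})$ is the $n\times\rho$ matrix with columns $\boldsymbol{\kappa}(\boldsymbol{x}_{p_1}),\dots,\boldsymbol{\kappa}(\boldsymbol{x}_{p_\rho})$; - $\boldsymbol{k}_{\boldsymbol{p}}(\mathcal{V})$ is the $\rho\times\rho$ matrix with columns $\boldsymbol{k}_{\boldsymbol{p}}(\boldsymbol{x}_{p_1}),\dots,\boldsymbol{k}_{\boldsymbol{p}}(\boldsymbol{x}_{p_\rho})$; - $\boldsymbol{k}^{\boldsymbol{p}}(\mathcal{V})$ is the $(n-\rho)\times\rho$ matrix with columns $\boldsymbol{k}^{\boldsymbol{p}}(\boldsymbol{x}_{p_1}),\dots,\boldsymbol{k}^{\boldsymbol{p}}(\boldsymbol{x}_{p_\rho})$. Operators. $\mathrm{diag}(\mathsf{M})$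 is the vector of diagonal entries of a square matrix $\mathsf{M}$; $\odot$ is the Hadamard (entrywise) product of matrices of equal size; $\mathrm{sum}(\mathsf{M})$ is the sum-by-rows operator, i.e. the column vector whose $i$-th entry is the sum of the entries of the $i$-th row of $\mathsf{M}$; the square root of a vector is taken entrywise. The vector $\boldsymbol{P}^{\mathcal{V}}$ collects the values at the points of $\mathcal{V}$ of the power function $P_{\kappa,\mathcal{X}\setminus\mathcal{V}}$ of the node set $\mathcal{X}\setminus\mathcal{V}$, where for a finite node set $\mathcal{Y}$ with kernel matrix $\mathsf{A}_{\mathcal{Y}}$ and kernel vector $\boldsymbol{\kappa}_{\mathcal{Y}}(\boldsymbol{x})=(\kappa(\boldsymbol{x},\boldsymbol{y}))_{\boldsymbol{y}\in\mathcal{Y}}$ one sets $P_{\kappa,\mathcal{Y}}(\boldsymbol{x})=\sqrt{\kappa(\boldsymbol{x},\boldsymbol{x})-\boldsymbol{\kappa}_{\mathcal{Y}}(\boldsymbol{x})^{\intercal}\mathsf{A}_{\mathcal{Y}}^{-1}\boldsymbol{\kappa}_{\mathcal{Y}}(\boldsymbol{x})}$. *)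

theory Defs
  imports
    "HOL-Analysis.Analysis"
    "Jordan_Normal_Form.Matrix"
    "Jordan_Normal_Form.Gauss_Jordan_Elimination"
begin

text \<open>
  Matrices and vectors of varying size are those of Jordan_Normal_Form, so all indices start
  at 0. A finite set of nodes is given by a list that enumerates it without repetition, and the
  order of the list is the order of the rows and columns of the kernel matrix.
\<close>

unbundle no vec_syntax
unbundle no inner_syntax

section \<open>Matrix operations\<close>

definition pos_def_mat :: "real mat \<Rightarrow> bool" where
  "pos_def_mat A \<longleftrightarrow> square_mat A \<and> transpose_mat A = A \<and>
     (\<forall>v \<in> carrier_vec (dim_row A). v \<noteq> 0\<^sub>v (dim_row A) \<longrightarrow> v \<bullet> (A *\<^sub>v v) > 0)"

text \<open>The value is unspecified if the matrix is not invertible.\<close>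

definition mat_inv :: "'a :: field mat \<Rightarrow> 'a mat" where
  "mat_inv A = the (mat_inverse A)"

lemma mat_inv:
  assumes "invertible_mat A"
  shows "inverts_mat A (mat_inv A)" and "inverts_mat (mat_inv A) A"
    and "mat_inv A \<in> carrier_mat (dim_row A) (dim_row A)"
proof -
  define n where "n = dim_row A"
  from assms obtain B where sq: "square_mat A" and B: "inverts_mat A B" "inverts_mat B A"
    unfolding invertible_mat_def by blast
  have A: "A \<in> carrier_mat n n"
    using sq by (auto simp: n_def)
  have AB: "A * B = 1\<^sub>m n"
    using B(1) by (simp add: inverts_mat_def n_def)
  have BA: "B * A = 1\<^sub>m (dim_row B)"
    using B(2) by (simp add: inverts_mat_def)
  have "dim_col B = n"
    using arg_cong[OF AB, of dim_col] by simp
  moreover have "dim_row B = n"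
    using arg_cong[OF BA, of dim_col] A by simp
  ultimately have "B \<in> carrier_mat n n"
    by auto
  then have "A \<in> Units (ring_mat TYPE('a) n ())"
    using A AB BA by (auto simp: Units_def ring_mat_def intro!: bexI[of _ B])
  then obtain C where C: "mat_inverse A = Some C"
    using mat_inverse(1)[OF A, of "()"] by (cases "mat_inverse A") auto
  have "A * C = 1\<^sub>m n" "C * A = 1\<^sub>m n" "C \<in> carrier_mat n n"
    using mat_inverse(2)[OF A C] by auto
  then show "inverts_mat A (mat_inv A)" "inverts_mat (mat_inv A) A"
    "mat_inv A \<in> carrier_mat (dim_row A) (dim_row A)"
    using C A by (auto simp: mat_inv_def inverts_mat_def)
qed

text \<open>Unlike \<^const>\<open>nths\<close>, the selections below respect the order of the index lists.\<close>

definition select_vec :: "'a Matrix.vec \<Rightarrow> nat list \<Rightarrow> 'a Matrix.vec" where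
  "select_vec v is = Matrix.vec (length is) (\<lambda>i. v $ (is ! i))"

definition select_mat :: "'a mat \<Rightarrow> nat list \<Rightarrow> nat list \<Rightarrow> 'a mat" where
  "select_mat A is js = Matrix.mat (length is) (length js) (\<lambda>(i, j). A $$ (is ! i, js ! j))"

definition other_indices :: "nat \<Rightarrow> nat list \<Rightarrow> nat list" where
  "other_indices n p = filter (\<lambda>i. i \<notin> set p) [0..<n]"

definition diag_vec :: "'a mat \<Rightarrow> 'a Matrix.vec" where
  "diag_vec M = Matrix.vec (dim_row M) (\<lambda>i. M $$ (i, i))"

definition hadamard :: "'a :: times mat \<Rightarrow> 'a mat \<Rightarrow> 'a mat" (infixl "\<odot>" 70) where
  "M \<odot> N = Matrix.mat (dim_row M) (dim_col M) (\<lambda>(i, j). M $$ (i, j) * N $$ (i, j))"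

definition row_sums :: "'a :: comm_monoid_add mat \<Rightarrow> 'a Matrix.vec" where
  "row_sums M = Matrix.vec (dim_row M) (\<lambda>i. \<Sum>j < dim_col M. M $$ (i, j))"

section \<open>Kernels\<close>

definition radial_on :: "'a :: real_normed_vector set \<Rightarrow> ('a \<Rightarrow> 'a \<Rightarrow> real) \<Rightarrow> bool" where
  "radial_on \<Omega> \<kappa> \<longleftrightarrow> (\<exists>\<phi> :: real \<Rightarrow> real. \<forall>x\<in>\<Omega>. \<forall>y\<in>\<Omega>. \<kappa> x y = \<phi> (norm (x - y)))"

definition kernel_mat :: "('a \<Rightarrow> 'a \<Rightarrow> real) \<Rightarrow> 'a list \<Rightarrow> real mat" where
  "kernel_mat \<kappa> ys = Matrix.mat (length ys) (length ys) (\<lambda>(i, j). \<kappa> (ys ! i) (ys ! j))"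

definition kernel_vec :: "('a \<Rightarrow> 'a \<Rightarrow> real) \<Rightarrow> 'a list \<Rightarrow> 'a \<Rightarrow> real Matrix.vec" where
  "kernel_vec \<kappa> ys x = Matrix.vec (length ys) (\<lambda>i. \<kappa> x (ys ! i))"

definition strictly_pos_def_on :: "'a set \<Rightarrow> ('a \<Rightarrow> 'a \<Rightarrow> real) \<Rightarrow> bool" where
  "strictly_pos_def_on \<Omega> \<kappa> \<longleftrightarrow>
     (\<forall>ys. distinct ys \<and> set ys \<subseteq> \<Omega> \<longrightarrow> pos_def_mat (kernel_mat \<kappa> ys))"

definition power_function :: "('a \<Rightarrow> 'a \<Rightarrow> real) \<Rightarrow> 'a list \<Rightarrow> 'a \<Rightarrow> real" where
  "power_function \<kappa> ys x =
     sqrt (\<kappa> x x - kernel_vec \<kappa> ys x \<bullet> (mat_inv (kernel_mat \<kappa> ys) *\<^sub>v kernel_vec \<kappa> ys x))"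

text \<open>Values at the points of \<open>vs\<close> of the power function of the nodes \<open>xs\<close> without \<open>vs\<close>.\<close>

definition power_vec :: "('a \<Rightarrow> 'a \<Rightarrow> real) \<Rightarrow> 'a list \<Rightarrow> 'a list \<Rightarrow> real Matrix.vec" where
  "power_vec \<kappa> xs vs =
     vec_of_list (map (power_function \<kappa> (filter (\<lambda>x. x \<notin> set vs) xs)) vs)"

text \<open>
  The matrix whose columns are, for the points of \<open>vs\<close>, the entries with indices \<open>is\<close> of the
  kernel vector of the nodes \<open>xs\<close>.
\<close>

definition kernel_cols ::
  "('a \<Rightarrow> 'a \<Rightarrow> real) \<Rightarrow> 'a list \<Rightarrow> nat list \<Rightarrow> 'a list \<Rightarrow> real mat" where
  "kernel_cols \<kappa> xs is vs =
     mat_of_cols (length is) (map (\<lambda>x. select_vec (kernel_vec \<kappa> xs x) is) vs)"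

end

theory Submission
  imports Defs "Jordan_Normal_Form.Determinant"
begin

text \<open>
  Write \<open>p\<close> for the selected indices, \<open>q\<close> for the others and \<open>B = A\<^sup>-\<^sup>1\<close>. The block form of \<open>B A = 1\<close> shows
  that the Schur complement \<open>A\<^sub>p\<^sub>p - A\<^sub>p\<^sub>q A\<^sub>q\<^sub>q\<^sup>-\<^sup>1 A\<^sub>q\<^sub>p\<close> is the inverse of \<open>B\<^sub>p\<^sub>p\<close>; its diagonal consists of
  the squared power function values. On the other side, the \<open>i\<close>-th row sum is the \<open>i\<close>-th
  diagonal entry of \<open>B\<^sub>p\<^sub>p\<^sup>-\<^sup>1 B\<^sub>p\<^sub>: A\<^sub>:\<^sub>p\<close>, which is \<open>B\<^sub>p\<^sub>p\<^sup>-\<^sup>1\<close> because \<open>B\<^sub>p\<^sub>: A\<^sub>:\<^sub>p = 1\<close>.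
\<close>

section \<open>Inverses\<close>

text \<open>Over a field a one-sided inverse of a square matrix is two-sided, hence unique. So
  \<open>mat_inv\<close> can be evaluated by exhibiting a right inverse, and invertibility of
  \<open>A\<close> comes for free.\<close>

lemma mat_inv_eqI:
  fixes A B :: "'a :: field mat"
  assumes A: "A \<in> carrier_mat n n" and B: "B \<in> carrier_mat n n" and AB: "A * B = 1\<^sub>m n"
  shows "mat_inv A = B"
proof -
  have BA: "B * A = 1\<^sub>m n"
    by (rule mat_mult_left_right_inverse[OF A B AB])
  have "invertible_mat A"
    using A B AB BA by (auto simp: invertible_mat_def inverts_mat_def intro!: exI[of _ B])
  then have inv: "A * mat_inv A = 1\<^sub>m n" "mat_inv A \<in> carrier_mat n n"
    using mat_inv[of A] A by (auto simp: inverts_mat_def)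
  have "mat_inv A = (B * A) * mat_inv A"
    using inv BA by simp
  also have "\<dots> = B * (A * mat_inv A)"
    using A B inv by simp
  also have "\<dots> = B"
    using inv B by simp
  finally show ?thesis .
qed

lemma mat_inv_carrier_mult:
  fixes A :: "'a :: field mat"
  assumes A: "A \<in> carrier_mat n n" and det: "Determinant.det A \<noteq> 0"
  shows "mat_inv A \<in> carrier_mat n n" and "A * mat_inv A = 1\<^sub>m n" and "mat_inv A * A = 1\<^sub>m n"
proof -
  obtain B where B: "B \<in> carrier_mat n n" "A * B = 1\<^sub>m n"
    using det_non_zero_imp_unit[OF A det, of "()"] by (auto simp: Units_def ring_mat_def)
  then have "mat_inv A = B"
    using mat_inv_eqI[OF A] by blast
  with B mat_mult_left_right_inverse[OF A B]
  show "mat_inv A \<in> carrier_mat n n" "A * mat_inv A = 1\<^sub>m n" "mat_inv A * A = 1\<^sub>m n"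
    by auto
qed

text \<open>A singular matrix has a nonzero \<open>v\<close> with \<open>A *\<^sub>v v = 0\<close>,
  at which the quadratic form would vanish.\<close>

lemma det_pos_def_mat:
  assumes "pos_def_mat A"
  shows "Determinant.det A \<noteq> 0"
proof
  let ?n = "dim_row A"
  assume "Determinant.det A = 0"
  moreover have "A \<in> carrier_mat ?n ?n"
    using assms by (auto simp: pos_def_mat_def)
  ultimately obtain v where v: "v \<in> carrier_vec ?n" "v \<noteq> 0\<^sub>v ?n" "A *\<^sub>v v = 0\<^sub>v ?n"
    using det_0_iff_vec_prod_zero by blast
  then have "v \<bullet> (A *\<^sub>v v) > 0"
    using assms by (auto simp: pos_def_mat_def)
  with v show False
    by simp
qed

section \<open>Submatrices\<close>

lemma select_mat_carrier [simp]: "select_mat M is js \<in> carrier_mat (length is) (length js)"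
  by (simp add: select_mat_def)

lemma dim_select_mat [simp]:
  "dim_row (select_mat M is js) = length is" "dim_col (select_mat M is js) = length js"
  by (simp_all add: select_mat_def)

lemma index_select_mat [simp]:
  "i < length is \<Longrightarrow> j < length js \<Longrightarrow> select_mat M is js $$ (i, j) = M $$ (is ! i, js ! j)"
  by (simp add: select_mat_def)

lemma set_other_indices: "set (other_indices n p) = {0..<n} - set p"
  by (auto simp: other_indices_def)

lemma select_mat_one_same:
  assumes "distinct is" "set is \<subseteq> {0..<n}"
  shows "select_mat (1\<^sub>m n) is is = 1\<^sub>m (length is)"
proof (rule eq_matI)
  fix i j assume "i < dim_row (1\<^sub>m (length is))" "j < dim_col (1\<^sub>m (length is))"
  moreover from this have "is ! i < n" "is ! j < n"
    using assms(2) nth_mem by force+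
  ultimately show "select_mat (1\<^sub>m n) is is $$ (i, j) = 1\<^sub>m (length is) $$ (i, j)"
    using assms(1) by (simp add: nth_eq_iff_index_eq)
qed auto

lemma select_mat_one_disjoint:
  assumes "set is \<inter> set js = {}" "set is \<subseteq> {0..<n}" "set js \<subseteq> {0..<n}"
  shows "select_mat (1\<^sub>m n) is js = 0\<^sub>m (length is) (length js)"
proof (rule eq_matI)
  fix i j assume "i < dim_row (0\<^sub>m (length is) (length js))" "j < dim_col (0\<^sub>m (length is) (length js))"
  then have ij: "i < length is" "j < length js"
    by simp_all
  then have "is ! i \<in> set is" "js ! j \<in> set js"
    by simp_all
  with assms have "is ! i < n" "js ! j < n" "is ! i \<noteq> js ! j"
    by auto
  with ij show "select_mat (1\<^sub>m n) is js $$ (i, j) = 0\<^sub>m (length is) (length js) $$ (i, j)"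
    by simp
qed auto

text \<open>Summing over \<open>set js\<close> instead of positions in \<open>js\<close> hides the
  order of the inner indices, so that sums over complementary index lists can be merged.\<close>

lemma index_mult_mat_select:
  assumes "i < length is" "j < length ks" "distinct js"
  shows "(select_mat M is js * select_mat N js ks) $$ (i, j) =
    (\<Sum>l\<in>set js. M $$ (is ! i, l) * N $$ (l, ks ! j))"
proof -
  have "(select_mat M is js * select_mat N js ks) $$ (i, j) =
      (\<Sum>l<length js. M $$ (is ! i, js ! l) * N $$ (js ! l, ks ! j))"
    using assms by (simp add: scalar_prod_def atLeast0LessThan)
  also have "\<dots> = (\<Sum>l\<in>set js. M $$ (is ! i, l) * N $$ (l, ks ! j))"
    by (rule sum.reindex_bij_betw[OF bij_betw_nth[OF assms(3) refl refl]])
  finally show ?thesis .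
qed

lemma select_mat_mult:
  assumes "M \<in> carrier_mat m n" "N \<in> carrier_mat n k"
    and "set is \<subseteq> {0..<m}" "set ks \<subseteq> {0..<k}"
  shows "select_mat (M * N) is ks = select_mat M is [0..<n] * select_mat N [0..<n] ks"
proof (rule eq_matI)
  fix i j
  assume "i < dim_row (select_mat M is [0..<n] * select_mat N [0..<n] ks)"
    "j < dim_col (select_mat M is [0..<n] * select_mat N [0..<n] ks)"
  then have ij: "i < length is" "j < length ks"
    by simp_all
  then have "is ! i < m" "ks ! j < k"
    using assms(3,4) nth_mem by force+
  then show "select_mat (M * N) is ks $$ (i, j) =
      (select_mat M is [0..<n] * select_mat N [0..<n] ks) $$ (i, j)"
    using ij assms(1,2)
    by (subst index_mult_mat_select) (simp_all add: scalar_prod_def)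
qed auto

text \<open>Block multiplication along the partition of \<open>{0..<n}\<close> into \<open>p\<close>
  and \<open>q\<close>. The list \<open>p\<close> may have any order, since entrywise only the set
  of inner indices matters.\<close>

lemma select_mat_mult_split:
  fixes M N :: "'a :: comm_semiring_0 mat"
  assumes "distinct p" "set p \<subseteq> {0..<n}"
  defines "q \<equiv> other_indices n p"
  shows "select_mat M is [0..<n] * select_mat N [0..<n] ks =
    select_mat M is p * select_mat N p ks + select_mat M is q * select_mat N q ks"
proof (rule eq_matI)
  let ?R = "select_mat M is p * select_mat N p ks + select_mat M is q * select_mat N q ks"
  fix i j
  assume "i < dim_row ?R" "j < dim_col ?R"
  then have ij: "i < length is" "j < length ks"
    by simp_all
  have "distinct q"
    by (simp add: q_def other_indices_def)
  moreover have "set q = {0..<n} - set p"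
    by (simp add: q_def set_other_indices)
  ultimately have "?R $$ (i, j) = (\<Sum>l\<in>set p. M $$ (is ! i, l) * N $$ (l, ks ! j)) +
      (\<Sum>l\<in>{0..<n} - set p. M $$ (is ! i, l) * N $$ (l, ks ! j))"
    using ij assms(1) by (simp add: index_mult_mat_select del: index_mult_mat(1))
  also have "\<dots> = (\<Sum>l\<in>{0..<n}. M $$ (is ! i, l) * N $$ (l, ks ! j))"
    using sum.subset_diff[OF assms(2), of "\<lambda>l. M $$ (is ! i, l) * N $$ (l, ks ! j)"]
    by (simp add: add.commute)
  also have "\<dots> = (select_mat M is [0..<n] * select_mat N [0..<n] ks) $$ (i, j)"
    using ij by (subst index_mult_mat_select) simp_all
  finally show "(select_mat M is [0..<n] * select_mat N [0..<n] ks) $$ (i, j) = ?R $$ (i, j)"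
    by simp
qed auto

text \<open>The Schur complement is shown to be a right inverse of \<open>?Bpp\<close>;
  invertibility of \<open>?Bpp\<close> is a by-product of \<open>mat_inv_eqI\<close>. Only the rows
  \<open>p\<close> of \<open>B * A = 1\<close> enter: columns \<open>p\<close> give
  \<open>pp\<close>, columns \<open>q\<close> give \<open>pq\<close>.\<close>

lemma mat_inv_select_mat_inv:
  fixes A :: "'a :: field mat"
  assumes A: "A \<in> carrier_mat n n" and det: "Determinant.det A \<noteq> 0"
    and p: "distinct p" "set p \<subseteq> {0..<n}"
  defines "q \<equiv> other_indices n p"
  assumes detq: "Determinant.det (select_mat A q q) \<noteq> 0"
  shows "mat_inv (select_mat (mat_inv A) p p) =
    select_mat A p p - select_mat A p q * mat_inv (select_mat A q q) * select_mat A q p"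
proof (rule mat_inv_eqI[of _ "length p"])
  define B where "B = mat_inv A"
  let ?r = "length p" and ?m = "length q"
  let ?Bpp = "select_mat B p p" and ?Bpq = "select_mat B p q"
  let ?App = "select_mat A p p" and ?Apq = "select_mat A p q"
  let ?Aqp = "select_mat A q p" and ?Aqq = "select_mat A q q"
  let ?I = "mat_inv ?Aqq"
  have B: "B \<in> carrier_mat n n" "B * A = 1\<^sub>m n"
    using mat_inv_carrier_mult[OF A det] by (simp_all add: B_def)
  have I: "?I \<in> carrier_mat ?m ?m" "?Aqq * ?I = 1\<^sub>m ?m"
    using mat_inv_carrier_mult[OF select_mat_carrier detq] by simp_all
  have q: "set q \<subseteq> {0..<n}" "set p \<inter> set q = {}"
    by (auto simp: q_def set_other_indices)
  have block: "?Bpp * select_mat A p ks + ?Bpq * select_mat A q ks = select_mat (1\<^sub>m n) p ks"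
    if "set ks \<subseteq> {0..<n}" for ks
    using select_mat_mult[OF B(1) A p(2) that] select_mat_mult_split[OF p, of B p A ks]
    by (simp add: B(2) q_def)
  have pp: "?Bpp * ?App + ?Bpq * ?Aqp = 1\<^sub>m ?r"
    using block[OF p(2)] p by (simp add: select_mat_one_same)
  have pq: "?Bpp * ?Apq + ?Bpq * ?Aqq = 0\<^sub>m ?r ?m"
    using block[OF q(1)] p q by (simp add: select_mat_one_disjoint)
  let ?X = "?Bpp * ?Apq" and ?Y = "?Bpq * ?Aqq"
  have X: "?X \<in> carrier_mat ?r ?m" and Y: "?Y \<in> carrier_mat ?r ?m"
    by (auto intro: mult_carrier_mat[OF select_mat_carrier select_mat_carrier])
  \<comment> \<open>The vanishing off-diagonal block, solved for the term containing
    \<open>?Bpp\<close>.\<close>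
  have XY: "?X = - ?Y"
  proof (rule eq_matI)
    fix i j assume "i < dim_row (- ?Y)" "j < dim_col (- ?Y)"
    then have ij: "i < ?r" "j < ?m" by simp_all
    have "(?X + ?Y) $$ (i, j) = 0"
      using ij by (simp only: pq index_zero_mat)
    then have "?X $$ (i, j) + ?Y $$ (i, j) = 0"
      using ij Y by (simp only: index_add_mat carrier_matD)
    then show "?X $$ (i, j) = (- ?Y) $$ (i, j)"
      using ij Y by (simp only: index_uminus_mat carrier_matD eq_neg_iff_add_eq_0)
  qed simp_all
  \<comment> \<open>Reassociate to expose \<open>?X\<close>, replace it by \<open>- ?Y\<close>, and
    cancel \<open>?Aqq\<close> against its inverse \<open>?I\<close>.\<close>
  have "?Bpp * (?Apq * ?I * ?Aqp) = ?Bpp * (?Apq * ?I) * ?Aqp"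
    using I by (intro assoc_mult_mat[of _ ?r ?r _ ?m _ ?r, symmetric] mult_carrier_mat[of _ ?r ?m])
      simp_all
  also have "?Bpp * (?Apq * ?I) = ?X * ?I"
    using I by (intro assoc_mult_mat[of _ ?r ?r _ ?m _ ?m, symmetric]) simp_all
  also have "?X * ?I * ?Aqp = - (?Y * ?I * ?Aqp)"
    using X Y I by (simp add: XY)
  also have "?Y * ?I = ?Bpq * (?Aqq * ?I)"
    using I by (intro assoc_mult_mat[of _ ?r ?m _ ?m _ ?m]) simp_all
  also have "\<dots> = ?Bpq"
    using I by (simp add: right_mult_one_mat[of _ ?r ?m])
  finally have Z: "?Bpp * (?Apq * ?I * ?Aqp) = - (?Bpq * ?Aqp)" .
  \<comment> \<open>By \<open>Z\<close> the subtracted term becomes an added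
    \<open>?Bpq * ?Aqp\<close>, and the sum is the left side of \<open>pp\<close>.\<close>
  have "?Bpp * (?App - ?Apq * ?I * ?Aqp) = ?Bpp * ?App - ?Bpp * (?Apq * ?I * ?Aqp)"
    using I by (intro mult_minus_distrib_mat[of _ ?r ?r _ ?r]) auto
  also have "\<dots> = ?Bpp * ?App + ?Bpq * ?Aqp"
    unfolding Z by (intro eq_matI) auto
  finally show "select_mat (mat_inv A) p p * (?App - ?Apq * ?I * ?Aqp) = 1\<^sub>m ?r"
    unfolding pp unfolding B_def .
  show "?App - ?Apq * ?I * ?Aqp \<in> carrier_mat ?r ?r"
    by (intro minus_carrier_mat) auto
qed simp

section \<open>Kernel matrices\<close>

lemma kernel_mat_carrier [simp]: "kernel_mat \<kappa> ys \<in> carrier_mat (length ys) (length ys)"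
  by (simp add: kernel_mat_def)

text \<open>Makes a principal submatrix a kernel matrix again, so strict positive definiteness
  applies to it and it can serve as the matrix in \<open>power_function\<close>.\<close>

lemma kernel_mat_map_nth:
  assumes "set is \<subseteq> {0..<length xs}"
  shows "kernel_mat \<kappa> (map ((!) xs) is) = select_mat (kernel_mat \<kappa> xs) is is"
proof (rule eq_matI)
  fix i j assume "i < dim_row (select_mat (kernel_mat \<kappa> xs) is is)"
    "j < dim_col (select_mat (kernel_mat \<kappa> xs) is is)"
  moreover from this have "is ! i < length xs" "is ! j < length xs"
    using assms nth_mem by force+
  ultimately show "kernel_mat \<kappa> (map ((!) xs) is) $$ (i, j) =
      select_mat (kernel_mat \<kappa> xs) is is $$ (i, j)"
    by (simp add: kernel_mat_def)
qed (simp_all add: kernel_mat_def)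

text \<open>The evaluation point is the first argument of the kernel in \<open>kernel_vec\<close>
  but the column node is the second one in \<open>kernel_mat\<close>; symmetry on the nodes
  reconciles them.\<close>

lemma kernel_cols_map_nth:
  assumes "set is \<subseteq> {0..<length xs}" "set p \<subseteq> {0..<length xs}"
    and sym: "\<And>x y. x \<in> set xs \<Longrightarrow> y \<in> set xs \<Longrightarrow> \<kappa> x y = \<kappa> y x"
  shows "kernel_cols \<kappa> xs is (map ((!) xs) p) = select_mat (kernel_mat \<kappa> xs) is p"
proof (rule eq_matI)
  fix i j assume "i < dim_row (select_mat (kernel_mat \<kappa> xs) is p)"
    "j < dim_col (select_mat (kernel_mat \<kappa> xs) is p)"
  moreover from this have "is ! i < length xs" "p ! j < length xs"
    using assms nth_mem by force+
  ultimately show "kernel_cols \<kappa> xs is (map ((!) xs) p) $$ (i, j) =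
      select_mat (kernel_mat \<kappa> xs) is p $$ (i, j)"
    by (simp add: kernel_cols_def kernel_mat_def kernel_vec_def select_vec_def mat_of_cols_index sym)
qed (simp_all add: kernel_cols_def)

lemma transpose_select_kernel_mat:
  assumes "set is \<subseteq> {0..<length xs}" "set js \<subseteq> {0..<length xs}"
    and sym: "\<And>x y. x \<in> set xs \<Longrightarrow> y \<in> set xs \<Longrightarrow> \<kappa> x y = \<kappa> y x"
  shows "transpose_mat (select_mat (kernel_mat \<kappa> xs) is js) = select_mat (kernel_mat \<kappa> xs) js is"
proof (rule eq_matI)
  fix i j assume "i < dim_row (select_mat (kernel_mat \<kappa> xs) js is)"
    "j < dim_col (select_mat (kernel_mat \<kappa> xs) js is)"
  moreover from this have "js ! i < length xs" "is ! j < length xs"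
    using assms nth_mem by force+
  ultimately show "transpose_mat (select_mat (kernel_mat \<kappa> xs) is js) $$ (i, j) =
      select_mat (kernel_mat \<kappa> xs) js is $$ (i, j)"
    by (simp add: kernel_mat_def sym)
qed simp_all

text \<open>\<open>power_vec\<close> discards nodes by value, the matrices discard them by index.
  Distinctness of the nodes makes both agree, and both keep the original order.\<close>

lemma filter_notin_map_nth:
  assumes "distinct xs" "set p \<subseteq> {0..<length xs}"
  shows "filter (\<lambda>x. x \<notin> set (map ((!) xs) p)) xs = map ((!) xs) (other_indices (length xs) p)"
proof -
  have "filter (\<lambda>x. x \<notin> set (map ((!) xs) p)) xs =
      filter (\<lambda>x. x \<notin> set (map ((!) xs) p)) (map ((!) xs) [0..<length xs])"
    by (simp only: map_nth)
  also have "\<dots> = map ((!) xs) (filter (\<lambda>i. xs ! i \<notin> (!) xs ` set p) [0..<length xs])"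
    by (simp add: filter_map o_def)
  also have "filter (\<lambda>i. xs ! i \<notin> (!) xs ` set p) [0..<length xs] = other_indices (length xs) p"
    unfolding other_indices_def
  proof (rule filter_cong[OF refl])
    fix i assume "i \<in> set [0..<length xs]"
    then show "(xs ! i \<notin> (!) xs ` set p) = (i \<notin> set p)"
      using assms by (force simp: nth_eq_iff_index_eq)
  qed
  finally show ?thesis .
qed

text \<open>In both vectors the \<open>i\<close>-th entry is the sum over \<open>j\<close> of
  \<open>M $$ (i, j) * N $$ (j, i)\<close>.\<close>

lemma row_sums_hadamard_transpose:
  assumes "M \<in> carrier_mat m n" "N \<in> carrier_mat n m"
  shows "row_sums (M \<odot> transpose_mat N) = diag_vec (M * N)"
  using assms
  by (intro eq_vecI) (simp_all add: row_sums_def hadamard_def diag_vec_def scalar_prod_def atLeast0LessThan)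

text \<open>By symmetry the kernel vector of the remaining nodes at the \<open>i\<close>-th removed
  node is both row \<open>i\<close> of \<open>select_mat A p q\<close> and column \<open>i\<close>
  of \<open>select_mat A q p\<close>. The quadratic form in the power function is thus a diagonal
  entry of the triple product.\<close>

lemma power_vec_eq_diag_schur_complement:
  assumes sym: "\<And>x y. x \<in> set xs \<Longrightarrow> y \<in> set xs \<Longrightarrow> \<kappa> x y = \<kappa> y x"
    and xs: "distinct xs" and p: "set p \<subseteq> {0..<length xs}"
  defines "A \<equiv> kernel_mat \<kappa> xs" and "q \<equiv> other_indices (length xs) p"
  assumes det: "Determinant.det (select_mat A q q) \<noteq> 0"
  shows "power_vec \<kappa> xs (map ((!) xs) p) =
    map_vec sqrt (diag_vec (select_mat A p p -
      select_mat A p q * mat_inv (select_mat A q q) * select_mat A q p))"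
proof (rule eq_vecI)
  let ?I = "mat_inv (select_mat A q q)"
  let ?C = "select_mat A p p - select_mat A p q * ?I * select_mat A q p"
  have I: "?I \<in> carrier_mat (length q) (length q)"
    using mat_inv_carrier_mult(1)[OF select_mat_carrier det] .
  have q: "set q \<subseteq> {0..<length xs}"
    by (auto simp: q_def set_other_indices)
  fix i assume "i < dim_vec (map_vec sqrt (diag_vec ?C))"
  then have i: "i < length p"
    by (simp add: diag_vec_def)
  then have pi: "p ! i < length xs"
    using p nth_mem by force
  let ?x = "xs ! (p ! i)" and ?ys = "map ((!) xs) q"
  have row: "kernel_vec \<kappa> ?ys ?x = Matrix.row (select_mat A p q) i"
    and col: "kernel_vec \<kappa> ?ys ?x = Matrix.col (select_mat A q p) i"
  proof -
    have "q ! j < length xs" if "j < length q" for j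
      using that q nth_mem by force
    then show "kernel_vec \<kappa> ?ys ?x = Matrix.row (select_mat A p q) i"
      "kernel_vec \<kappa> ?ys ?x = Matrix.col (select_mat A q p) i"
      using i pi by (auto simp: kernel_vec_def A_def kernel_mat_def sym intro!: eq_vecI)
  qed
  \<comment> \<open>Bracketing to the right turns column \<open>i\<close> of the right factor into
    \<open>?I\<close> applied to a column, the shape used in \<open>power_function\<close>.\<close>
  have "(select_mat A p q * ?I * select_mat A q p) $$ (i, i) =
      (select_mat A p q * (?I * select_mat A q p)) $$ (i, i)"
    using I by (simp add: assoc_mult_mat[OF select_mat_carrier I select_mat_carrier])
  also have "\<dots> = Matrix.row (select_mat A p q) i \<bullet> (?I *\<^sub>v Matrix.col (select_mat A q p) i)"
    using i I by (simp add: col_mult2[OF I select_mat_carrier])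
  finally have "?C $$ (i, i) =
      \<kappa> ?x ?x - Matrix.row (select_mat A p q) i \<bullet> (?I *\<^sub>v Matrix.col (select_mat A q p) i)"
    using i pi I by (simp add: A_def kernel_mat_def del: index_mult_mat(1))
  moreover have "power_vec \<kappa> xs (map ((!) xs) p) $ i = power_function \<kappa> ?ys ?x"
    using i by (simp only: power_vec_def filter_notin_map_nth[OF xs p] q_def)
      (simp add: vec_of_list_index)
  moreover have "kernel_mat \<kappa> ?ys = select_mat A q q"
    by (simp add: A_def kernel_mat_map_nth[OF q])
  ultimately show "power_vec \<kappa> xs (map ((!) xs) p) $ i = map_vec sqrt (diag_vec ?C) $ i"
    using i by (simp add: diag_vec_def power_function_def row[symmetric] col[symmetric])
qed (simp add: power_vec_def diag_vec_def)

theorem theorem1: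
  fixes \<Omega> :: "(real ^ 'd) set" and \<kappa> :: "real ^ 'd \<Rightarrow> real ^ 'd \<Rightarrow> real"
    and xs :: "(real ^ 'd) list" and p :: "nat list" and n \<rho> :: nat
  assumes "radial_on \<Omega> \<kappa>" and "strictly_pos_def_on \<Omega> \<kappa>"
    and "length xs = n" and "distinct xs" and "set xs \<subseteq> \<Omega>"
    and "1 \<le> \<rho>" and "\<rho> < n"
    and "length p = \<rho>" and "distinct p" and "set p \<subseteq> {0..<n}"
  defines "A \<equiv> kernel_mat \<kappa> xs"
    and "q \<equiv> other_indices n p"
    and "V \<equiv> map (\<lambda>i. xs ! i) p"
  shows "power_vec \<kappa> xs V =
           map_vec sqrt (diag_vec (kernel_cols \<kappa> xs p V -
             transpose_mat (kernel_cols \<kappa> xs q V) * mat_inv (select_mat A q q) *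
               kernel_cols \<kappa> xs q V)) \<and>
         power_vec \<kappa> xs V =
           map_vec sqrt (row_sums
             ((mat_inv (select_mat (mat_inv A) p p) * select_mat (mat_inv A) p [0..<n])
               \<odot> transpose_mat (kernel_cols \<kappa> xs [0..<n] V)))"
proof -
  have n: "n = length xs"
    using assms(3) by simp
  have p: "distinct p" "set p \<subseteq> {0..<n}" and pl: "set p \<subseteq> {0..<length xs}"
    using assms(9,10) by (simp_all add: n)
  have q: "set q \<subseteq> {0..<n}" "distinct q" and ql: "set q \<subseteq> {0..<length xs}"
    by (auto simp: q_def set_other_indices n, simp add: other_indices_def)
  \<comment> \<open>A radial kernel depends only on \<open>norm (x - y)\<close>, which is
    symmetric.\<close>
  have sym: "\<kappa> x y = \<kappa> y x" if "x \<in> set xs" "y \<in> set xs" for x y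
    using assms(1,5) that unfolding radial_on_def by (metis norm_minus_commute subsetD)
  have A: "A \<in> carrier_mat n n"
    by (simp add: A_def n)
  have det: "Determinant.det A \<noteq> 0"
    using assms(2,4,5) by (simp add: A_def det_pos_def_mat strictly_pos_def_on_def)
  \<comment> \<open>Strict positive definiteness is applied a second time, to the remaining
    nodes.\<close>
  have "distinct (map ((!) xs) q)" "set (map ((!) xs) q) \<subseteq> \<Omega>"
    using q assms(4,5) by (force simp: distinct_map n intro!: inj_on_nth)+
  then have detq: "Determinant.det (select_mat A q q) \<noteq> 0"
    using assms(2) unfolding A_def kernel_mat_map_nth[OF ql, symmetric] strictly_pos_def_on_def
    by (intro det_pos_def_mat) blast
  have cols: "kernel_cols \<kappa> xs is V = select_mat A is p" if "set is \<subseteq> {0..<length xs}" for "is"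
    unfolding V_def A_def using kernel_cols_map_nth[OF that pl sym] by simp
  have tr: "transpose_mat (select_mat A q p) = select_mat A p q"
    unfolding A_def by (rule transpose_select_kernel_mat[OF ql pl sym])
  let ?C = "select_mat A p p - select_mat A p q * mat_inv (select_mat A q q) * select_mat A q p"
  have C: "mat_inv (select_mat (mat_inv A) p p) = ?C"
    unfolding q_def by (rule mat_inv_select_mat_inv[OF A det p]) (use detq in \<open>simp add: q_def\<close>)
  have Cc: "?C \<in> carrier_mat (length p) (length p)"
    by (intro minus_carrier_mat) auto
  let ?R = "select_mat (mat_inv A) p [0..<n]" and ?N = "select_mat A [0..<n] p"
  have R: "?R \<in> carrier_mat (length p) n" and N: "?N \<in> carrier_mat n (length p)"
    by (auto intro: carrier_matI)
  note inv = mat_inv_carrier_mult[OF A det]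
  \<comment> \<open>With the full range as inner indices, this product is the \<open>p\<close> block
    of \<open>mat_inv A * A\<close>.\<close>
  have RN: "?R * ?N = 1\<^sub>m (length p)"
    using select_mat_mult[OF inv(1) A p(2) p(2)] p by (simp add: inv(3) select_mat_one_same)
  have "row_sums (?C * ?R \<odot> transpose_mat ?N) = diag_vec (?C * ?R * ?N)"
    by (rule row_sums_hadamard_transpose[OF mult_carrier_mat[OF Cc R] N])
  also have "?C * ?R * ?N = ?C"
    using assoc_mult_mat[OF Cc R N] Cc by (simp add: RN)
  finally have sums: "row_sums (?C * ?R \<odot> transpose_mat ?N) = diag_vec ?C" .
  have "power_vec \<kappa> xs V = map_vec sqrt (diag_vec ?C)"
    unfolding V_def A_def q_def n
    by (rule power_vec_eq_diag_schur_complement[OF sym assms(4) pl])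
      (use detq in \<open>simp_all add: A_def q_def n\<close>)
  \<comment> \<open>Both claimed formulas reduce to the entrywise root of
    \<open>diag_vec ?C\<close>: the first through \<open>cols\<close> and \<open>tr\<close>, the
    second through \<open>C\<close>, \<open>cols\<close> and \<open>sums\<close>.\<close>
  then show ?thesis
    using sums by (simp add: C cols pl ql tr n)
qed

end
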